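(* Let $p$ be an odd prime. For every integer $s\ge 1$ the polynomials $P_s(x)$ satisfy $$P_{s+1}(x)\,P_{s-1}(x^p)\equiv P_s(x)\,P_s(x^p)\pmod{p^s}$$ (coefficientwise congruence in $\mathbb{Z}[x]$).
   Context: For $s\ge1$, $P_s(x)$ is the coefficient of $t^{p^s-1}$ in the master polynomial $t^{(p^s-1)/2}(t-1)^{(p^s-1)/2}(t-x)^{(p^s-1)/2}$, that is, $$P_s(x)=(-1)^{(p^s-1)/2}\sum_{k=0}^{(p^s-1)/2}\binom{(p^s-1)/2}{k}^2x^k,$$ and $P_0(x)=1$. *)

theory Defs
  imports "HOL-Computational_Algebra.Computational_Algebra" "HOL-Number_Theory.Cong"
begin

text \<open>An element of \<^typ>\<open>int poly poly\<close> is a polynomial in \<open>t\<close> with coefficients in \<open>\<int>[x]\<close>: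
  \<open>[:0, 1:] :: int poly poly\<close> is \<open>t\<close>, and the inner \<open>[:0, 1:] :: int poly\<close> is \<open>x\<close>.\<close>

definition master_poly :: "nat \<Rightarrow> nat \<Rightarrow> int poly poly" where
  "master_poly p s =
     [:0, 1:] ^ ((p ^ s - 1) div 2) *
     [:- 1, 1:] ^ ((p ^ s - 1) div 2) *
     [:- [:0, 1:], 1:] ^ ((p ^ s - 1) div 2)"

definition P :: "nat \<Rightarrow> nat \<Rightarrow> int poly" where
  "P p s = (if s = 0 then 1 else coeff (master_poly p s) (p ^ s - 1))"

lemma coeff_linear_power_int_poly:
  "coeff ([:- a, 1:] ^ m :: int poly poly) k =
     (if k \<le> m then of_nat (m choose k) * (- a) ^ (m - k) else 0)"
proof (cases "k \<le> m")
  case True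
  then show ?thesis using coeff_linear_poly_power[of k m "- a" 1] by simp
next
  case False
  have "degree ([:- a, 1:] ^ m :: int poly poly) \<le> m"
    by (rule order_trans[OF degree_power_le]) simp
  with False show ?thesis by (simp add: coeff_eq_0)
qed

lemma P_eq_sum:
  assumes "odd p" "s \<ge> 1"
  shows "P p s = (- 1) ^ ((p ^ s - 1) div 2) *
           (\<Sum>k\<le>(p ^ s - 1) div 2. monom (int ((((p ^ s - 1) div 2) choose k) ^ 2)) k)"
proof -
  define m where "m = (p ^ s - 1) div 2"
  have "odd (p ^ s)" using assms by simp
  then have m2: "p ^ s - 1 = m + m" unfolding m_def by presburger
  have t: "[:0, 1:] ^ m = (monom 1 m :: int poly poly)"
    by (simp add: monom_altdef)
  have x: "[:0, 1:] ^ k = (monom 1 k :: int poly)" for k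
    by (simp add: monom_altdef)
  have "P p s = coeff ([:- 1, 1:] ^ m * [:- [:0, 1:], 1:] ^ m :: int poly poly) m"
    using assms unfolding P_def master_poly_def m_def[symmetric] t mult.assoc
    unfolding m2 by (simp add: coeff_monom_mult)
  also have "\<dots> = (\<Sum>k\<le>m. coeff ([:- 1, 1:] ^ m) k * coeff ([:- [:0, 1:], 1:] ^ m) (m - k))"
    by (simp add: coeff_mult)
  also have "\<dots> = (\<Sum>k\<le>m. (- 1) ^ m * monom (int ((m choose k) ^ 2)) k)"
  proof (rule sum.cong[OF refl])
    fix k assume "k \<in> {..m}"
    then have k: "k \<le> m" by simp
    have s: "(- 1 :: int poly) ^ m = (- 1) ^ (m - k) * (- 1) ^ k"
      using k by (simp flip: power_add)
    have n: "(- [:0, 1:] :: int poly) ^ k = (- 1) ^ k * monom 1 k"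
      by (subst power_minus) (simp only: x)
    have q: "monom (int ((m choose k) ^ 2)) k
           = of_nat (m choose k) * of_nat (m choose k) * (monom 1 k :: int poly)"
      by (simp add: of_nat_poly smult_monom power2_eq_square)
    show "coeff ([:- 1, 1:] ^ m) k * coeff ([:- [:0, 1:], 1:] ^ m) (m - k)
        = (- 1) ^ m * monom (int ((m choose k) ^ 2)) k"
      unfolding coeff_linear_power_int_poly q s using k
      by (simp only: n binomial_symmetric[OF k, symmetric] diff_le_self if_True diff_diff_cancel ac_simps)
  qed
  finally show ?thesis by (simp add: m_def sum_distrib_left)
qed

end

theory Submission
  imports Defs
begin

text \<open>
  Write \<open>\<Phi> = (t (t - 1) (t - x))\<^sup>h\<close> with \<open>h = (p - 1) / 2\<close>. Since
  \<open>(p\<^sup>s - 1) / 2 = h (1 + p + \<dots> + p\<^sup>s\<^sup>-\<^sup>1)\<close>, the master polynomial is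
  \<open>F\<^sub>s = \<Phi> \<Phi>\<^sup>p \<dots> \<Phi>^(p\<^sup>s\<^sup>-\<^sup>1)\<close>. Let \<open>\<tau>\<^sub>k\<close> be the substitution of
  \<open>t^(p\<^sup>k)\<close>, \<open>x^(p\<^sup>k)\<close> for \<open>t\<close>, \<open>x\<close>, and \<open>\<sigma>\<^sub>k\<close> the substitution of
  \<open>x^(p\<^sup>k)\<close> for \<open>x\<close> on the coefficients. Define \<open>B\<^sub>1, B\<^sub>2, \<dots>\<close> by solving
  \<open>F\<^sub>s = \<Sum>\<^sub>k B\<^sub>k \<tau>\<^sub>k(F\<^sub>s\<^sub>-\<^sub>k)\<close>, \<open>1 \<le> k \<le> s\<close>, successively. Three facts
  give the congruence.

  \<^item> \<open>p\<^sup>k\<^sup>-\<^sup>1\<close> divides \<open>B\<^sub>k\<close> (\<open>power_dvd_indecomposable\<close>). The reason is the Frobenius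
    congruence \<open>\<Phi>^(p\<^sup>k) \<equiv> \<tau>\<^sub>k(\<Phi>)\<close> modulo \<open>p\<close>, which improves to a congruence modulo
    \<open>p\<^sup>s\<^sup>-\<^sup>k\<^sup>+\<^sup>1\<close> after raising both sides to the power \<open>p\<^sup>s\<^sup>-\<^sup>k\<close>.

  \<^item> The degree of \<open>B\<^sub>k\<close> in \<open>t\<close> is at most \<open>3 (p\<^sup>k - 1) / 2\<close>, so the only exponent
    congruent to \<open>-1\<close> modulo \<open>p\<^sup>k\<close> that can occur in \<open>B\<^sub>k\<close> is \<open>p\<^sup>k - 1\<close>. Comparing
    coefficients of \<open>t^(p\<^sup>s - 1)\<close> therefore turns the relation between the \<open>F\<^sub>s\<close> into
    \<open>P\<^sub>s = \<Sum>\<^sub>k A\<^sub>k \<sigma>\<^sub>k(P\<^sub>s\<^sub>-\<^sub>k)\<close>, where \<open>A\<^sub>k\<close> is the coefficient of \<open>t^(p\<^sup>k - 1)\<close>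
    in \<open>B\<^sub>k\<close> and is again divisible by \<open>p\<^sup>k\<^sup>-\<^sup>1\<close> (\<open>P_recursion\<close>).

  \<^item> Any sequence with such a recursion satisfies congruences of Dwork type
    (\<open>dwork_congruence_of_recursion\<close>): expanding both sides of the congruence, each \<open>A\<^sub>k\<close> but
    the last, which is divisible enough by itself, gets multiplied by the image under some
    \<open>\<sigma>\<^sub>j\<close> of a difference of the same shape, and the power of \<open>p\<close> that such a difference
    has lost in comparison is the one that \<open>A\<^sub>k\<close> supplies.
\<close>

section \<open>Congruences modulo powers of a prime in commutative rings\<close>

lemma dvd_mult_diff:
  fixes a b c d m :: "'a::comm_ring_1"
  assumes "m dvd a - b" "m dvd c - d"
  shows "m dvd a * c - b * d"
proof -
  have "a * c - b * d = (a - b) * c + b * (c - d)" by (simp add: algebra_simps)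
  then show ?thesis using assms by simp
qed

lemma dvd_power_diff:
  fixes a b m :: "'a::comm_ring_1"
  assumes "m dvd a - b"
  shows "m dvd a ^ n - b ^ n"
  by (induction n) (auto intro: dvd_mult_diff assms)

lemma dvd_diff_trans:
  fixes a b c m :: "'a::comm_ring_1"
  assumes "m dvd a - b" "m dvd b - c"
  shows "m dvd a - c"
  using dvd_add[OF assms] by simp

text \<open>
  Passing from \<open>u - v\<close> to \<open>u\<^sup>p - v\<^sup>p\<close> gains one factor \<open>p\<close>: the cofactor
  \<open>\<Sum>\<^sub>i v\<^sup>p\<^sup>-\<^sup>1\<^sup>-\<^sup>i u\<^sup>i\<close> has \<open>p\<close> summands, all congruent to \<open>v\<^sup>p\<^sup>-\<^sup>1\<close>.
\<close>

lemma lift_dvd_power_diff: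
  fixes a b :: "'a::comm_ring_1"
  assumes "of_nat p dvd a - b"
  shows "of_nat p ^ Suc j dvd a ^ (p ^ j) - b ^ (p ^ j)"
proof (induction j)
  case 0
  then show ?case using assms by simp
next
  case (Suc j)
  define u v where "u = a ^ (p ^ j)" and "v = b ^ (p ^ j)"
  have IH: "of_nat p ^ Suc j dvd u - v" using Suc by (simp add: u_def v_def)
  have uv: "of_nat p dvd u - v" unfolding u_def v_def by (rule dvd_power_diff[OF assms])
  have summand: "of_nat p dvd v ^ (p - Suc i) * u ^ i - v ^ (p - 1)" if "i < p" for i
  proof -
    have "v ^ (p - 1) = v ^ (p - Suc i) * v ^ i"
      using that by (simp flip: power_add)
    then show ?thesis
      using dvd_power_diff[OF uv, of i] by (simp flip: right_diff_distrib)
  qed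
  have "of_nat p dvd (\<Sum>i<p. v ^ (p - Suc i) * u ^ i - v ^ (p - 1))"
    by (rule dvd_sum) (use summand in auto)
  then have "of_nat p dvd (\<Sum>i<p. v ^ (p - Suc i) * u ^ i) - of_nat p * v ^ (p - 1)"
    by (simp add: sum_subtractf)
  then have "of_nat p dvd (\<Sum>i<p. v ^ (p - Suc i) * u ^ i)"
    by (metis dvd_triv_left dvd_diff_commute diff_add_cancel dvd_add)
  then have "of_nat p ^ Suc j * of_nat p dvd (u - v) * (\<Sum>i<p. v ^ (p - Suc i) * u ^ i)"
    using IH by (rule mult_dvd_mono[rotated])
  also have "\<dots> = u ^ p - v ^ p" by (rule power_diff_sumr2[symmetric])
  also have "\<dots> = a ^ (p ^ Suc j) - b ^ (p ^ Suc j)"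
    by (simp add: u_def v_def mult.commute flip: power_mult)
  finally show ?case by (simp add: mult.commute)
qed

lemma prime_dvd_binomial_power_diff:
  fixes a b :: "'a::comm_ring_1"
  assumes "prime p"
  shows "of_nat p dvd (a + b) ^ p - (a ^ p + b ^ p)"
proof -
  have p: "p > 0" using assms prime_gt_0_nat by blast
  have "(a + b) ^ p = (\<Sum>k\<le>p. of_nat (p choose k) * a ^ k * b ^ (p - k))"
    by (rule binomial_ring)
  also have "{..p} = insert 0 (insert p {0<..<p})" using p by auto
  finally have "(a + b) ^ p - (a ^ p + b ^ p)
      = (\<Sum>k\<in>{0<..<p}. of_nat (p choose k) * a ^ k * b ^ (p - k))"
    using p by simp
  also have "of_nat p dvd \<dots>"
  proof (rule dvd_sum)
    fix k assume "k \<in> {0<..<p}"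
    then have "p dvd p choose k" using assms by (intro dvd_choose_prime) auto
    then have "(of_nat p :: 'a) dvd of_nat (p choose k)" by (auto simp: dvd_def)
    then show "of_nat p dvd of_nat (p choose k) * a ^ k * b ^ (p - k)" by simp
  qed
  finally show ?thesis .
qed

lemma prime_dvd_power_add_diff:
  fixes a b :: "'a::comm_ring_1"
  assumes "prime p"
  shows "of_nat p dvd (a + b) ^ (p ^ k) - (a ^ (p ^ k) + b ^ (p ^ k))"
proof (induction k)
  case 0
  then show ?case by simp
next
  case (Suc k)
  from dvd_power_diff[OF this, of p]
  have "of_nat p dvd (a + b) ^ (p ^ Suc k) - (a ^ (p ^ k) + b ^ (p ^ k)) ^ p"
    by (simp add: mult.commute flip: power_mult)
  moreover have "of_nat p dvd (a ^ (p ^ k) + b ^ (p ^ k)) ^ p - (a ^ (p ^ Suc k) + b ^ (p ^ Suc k))"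
    using prime_dvd_binomial_power_diff[OF assms, of "a ^ (p ^ k)" "b ^ (p ^ k)"]
    by (simp add: mult.commute flip: power_mult)
  ultimately show ?case by (rule dvd_diff_trans)
qed

section \<open>Decomposing a product of Frobenius powers\<close>

text \<open>
  These are the coefficients of \<open>F\<^sub>s = \<Sum>\<^sub>k B\<^sub>k \<tau>\<^sub>k(F\<^sub>s\<^sub>-\<^sub>k)\<close>, obtained by solving for
  \<open>B\<^sub>s\<close>: what remains of \<open>F\<^sub>s\<close> once every contribution with a factor
  \<open>\<tau>\<^sub>k(F\<^sub>s\<^sub>-\<^sub>k)\<close>, \<open>0 < k < s\<close>, has been split off.
\<close>

fun indecomposable :: "(nat \<Rightarrow> 'a \<Rightarrow> 'a) \<Rightarrow> (nat \<Rightarrow> 'a) \<Rightarrow> nat \<Rightarrow> 'a::comm_ring_1" where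
  "indecomposable \<tau> F s = F s - (\<Sum>k\<in>{1..<s}. indecomposable \<tau> F k * \<tau> k (F (s - k)))"

declare indecomposable.simps [simp del]

lemma sum_indecomposable:
  assumes "\<tau> s (F 0) = 1" "s \<ge> 1"
  shows "F s = (\<Sum>k\<in>{1..s}. indecomposable \<tau> F k * \<tau> k (F (s - k)))"
proof -
  have "{1..s} = insert s {1..<s}" using assms by auto
  then show ?thesis using assms by (simp add: indecomposable.simps[of \<tau> F s])
qed

text \<open>
  Comparing \<open>\<Phi>^(p\<^sup>s)\<close> times the decomposition of \<open>F\<^sub>s\<close> with that of \<open>F\<^sub>s\<^sub>+\<^sub>1\<close> gives
  \<open>B\<^sub>s\<^sub>+\<^sub>1 = \<Sum>\<^sub>k B\<^sub>k \<tau>\<^sub>k(F\<^sub>s\<^sub>-\<^sub>k) (\<Phi>^(p\<^sup>s) - \<tau>\<^sub>k(\<Phi>)^(p\<^sup>s\<^sup>-\<^sup>k))\<close>. Here \<open>B\<^sub>k\<close>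
  contributes \<open>k - 1\<close> factors \<open>p\<close> by induction, and the difference contributes the
  remaining \<open>s - k + 1\<close>.
\<close>

lemma power_dvd_indecomposable:
  fixes \<Phi> :: "'a::comm_ring_1"
  assumes F: "\<And>s. F s = (\<Prod>i<s. \<Phi> ^ (p ^ i))"
    and one: "\<And>k. \<tau> k 1 = 1"
    and mult: "\<And>k a b. \<tau> k (a * b) = \<tau> k a * \<tau> k b"
    and frob: "\<And>k. of_nat p dvd \<Phi> ^ (p ^ k) - \<tau> k \<Phi>"
  shows "of_nat p ^ s dvd indecomposable \<tau> F (Suc s)"
proof (induction s rule: less_induct)
  case (less s)
  let ?B = "indecomposable \<tau> F"
  have pow: "\<tau> k (a ^ n) = \<tau> k a ^ n" for k a n
    by (induction n) (simp_all add: one mult)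
  have F_Suc: "F (Suc n) = F n * \<Phi> ^ (p ^ n)" for n by (simp add: F)
  show ?case
  proof (cases "s = 0")
    case False
    have "F s = (\<Sum>k\<in>{1..s}. ?B k * \<tau> k (F (s - k)))"
      using False by (intro sum_indecomposable) (simp_all add: F one)
    then have "F (Suc s) = (\<Sum>k\<in>{1..s}. ?B k * \<tau> k (F (s - k)) * \<Phi> ^ (p ^ s))"
      unfolding F_Suc by (simp add: sum_distrib_right)
    moreover have "{1..<Suc s} = {1..s}" by auto
    ultimately have "?B (Suc s)
        = (\<Sum>k\<in>{1..s}. ?B k * \<tau> k (F (s - k)) * \<Phi> ^ (p ^ s))
          - (\<Sum>k\<in>{1..s}. ?B k * \<tau> k (F (Suc s - k)))"
      by (subst indecomposable.simps) simp
    also have "\<dots> = (\<Sum>k\<in>{1..s}. ?B k * \<tau> k (F (s - k)) * (\<Phi> ^ (p ^ s) - \<tau> k \<Phi> ^ (p ^ (s - k))))"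
      unfolding sum_subtractf[symmetric]
      by (rule sum.cong) (simp_all add: Suc_diff_le F_Suc mult pow algebra_simps)
    also have "of_nat p ^ s dvd \<dots>"
    proof (rule dvd_sum)
      fix k assume k: "k \<in> {1..s}"
      then obtain j where j: "k = Suc j" "j < s" by (cases k) auto
      have B: "of_nat p ^ j dvd ?B k" using less j by simp
      have "\<Phi> ^ (p ^ s) = (\<Phi> ^ (p ^ k)) ^ (p ^ (s - k))"
        using k by (simp flip: power_mult power_add)
      then have "of_nat p ^ Suc (s - k) dvd \<Phi> ^ (p ^ s) - \<tau> k \<Phi> ^ (p ^ (s - k))"
        using lift_dvd_power_diff[OF frob] by simp
      from mult_dvd_mono[OF B this]
      have "of_nat p ^ s dvd ?B k * (\<Phi> ^ (p ^ s) - \<tau> k \<Phi> ^ (p ^ (s - k)))"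
        using j by (simp flip: power_Suc power_add del: power_Suc)
      then have "of_nat p ^ s dvd ?B k * (\<Phi> ^ (p ^ s) - \<tau> k \<Phi> ^ (p ^ (s - k))) * \<tau> k (F (s - k))"
        by (rule dvd_mult2)
      then show "of_nat p ^ s dvd ?B k * \<tau> k (F (s - k)) * (\<Phi> ^ (p ^ s) - \<tau> k \<Phi> ^ (p ^ (s - k)))"
        by (simp add: ac_simps)
    qed
    finally show ?thesis .
  qed simp
qed

section \<open>Dwork congruences from a recursion\<close>

text \<open>
  Let \<open>D(n, e)\<close> be the difference in the conclusion; the congruence of interest is \<open>e = 1\<close>,
  but the induction needs all \<open>e\<close>. Expanding \<open>a\<^sub>n\<^sub>+\<^sub>1\<^sub>+\<^sub>e\<close> and \<open>a\<^sub>n\<^sub>+\<^sub>e\<close> by the recursion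
  multiplies \<open>A\<^sub>k\<close> by \<open>\<sigma>\<^sub>k(D(n, e - k))\<close> if \<open>k \<le> e\<close>, which is divisible by
  \<open>p\<^sup>n\<^sup>+\<^sup>1\<close>, and by \<open>- \<sigma>\<^sub>e(D(n + e - k, k - e))\<close> if \<open>e < k \<le> n + e\<close>, which is
  divisible only by \<open>p\<^sup>n\<^sup>+\<^sup>e\<^sup>-\<^sup>k\<^sup>+\<^sup>1\<close>. In the second case \<open>A\<^sub>k\<close> supplies the factor
  \<open>p\<^sup>k\<^sup>-\<^sup>1\<close>, and \<open>e \<ge> 1\<close> makes this enough. Both pairs have a smaller sum than \<open>(n, e)\<close>.
  The last term, \<open>k = n + e + 1\<close>, occurs in one of the two expansions only and is harmless
  because \<open>p\<^sup>n\<^sup>+\<^sup>e\<close> divides \<open>A\<^sub>k\<close>. Chaining the congruences with \<open>e = 1\<close> would not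
  replace the induction over all \<open>e\<close>: it requires cancelling elements \<open>a\<^sub>i\<close>, which may be
  zero divisors modulo \<open>p\<close>.
\<close>

lemma dwork_congruence_of_recursion:
  fixes a A :: "nat \<Rightarrow> 'a::comm_ring_1" and \<sigma> :: "nat \<Rightarrow> 'a \<Rightarrow> 'a"
  assumes rec: "\<And>s. s \<ge> 1 \<Longrightarrow> a s = (\<Sum>k\<in>{1..s}. A k * \<sigma> k (a (s - k)))"
    and A: "\<And>k. of_nat p ^ k dvd A (Suc k)"
    and id: "\<And>x. \<sigma> 0 x = x"
    and comp: "\<And>j k x. \<sigma> j (\<sigma> k x) = \<sigma> (j + k) x"
    and one: "\<And>k. \<sigma> k 1 = 1"
    and diff: "\<And>k x y. \<sigma> k (x - y) = \<sigma> k x - \<sigma> k y"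
    and mult: "\<And>k x y. \<sigma> k (x * y) = \<sigma> k x * \<sigma> k y"
  shows "of_nat p ^ Suc n dvd a (Suc n + e) * \<sigma> e (a n) - a (n + e) * \<sigma> e (a (Suc n))"
proof (induction "n + e" arbitrary: n e rule: less_induct)
  case less
  have \<sigma>0: "\<sigma> k 0 = 0" for k using diff[of k 0 0] by simp
  have \<sigma>_neg: "\<sigma> k (- x) = - \<sigma> k x" for k x using diff[of k 0 x] \<sigma>0 by simp
  have \<sigma>_add: "\<sigma> k (x + y) = \<sigma> k x + \<sigma> k y" for k x y
    using diff[of k x "- y"] \<sigma>_neg by simp
  have \<sigma>_nat: "\<sigma> k (of_nat m) = of_nat m" for k m
    by (induction m) (simp_all add: \<sigma>0 \<sigma>_add one)
  have \<sigma>_pow: "\<sigma> k (of_nat p ^ m) = of_nat p ^ m" for k m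
    by (induction m) (simp_all add: one mult \<sigma>_nat)
  have \<sigma>_dvd: "of_nat p ^ m dvd \<sigma> k x" if "of_nat p ^ m dvd x" for k m x
    using that by (auto simp: dvd_def mult \<sigma>_pow)
  let ?D = "\<lambda>n e. a (Suc n + e) * \<sigma> e (a n) - a (n + e) * \<sigma> e (a (Suc n))"
  show ?case
  proof (cases "e = 0")
    case True
    then show ?thesis by (simp add: id)
  next
    case False
    let ?T = "\<lambda>k. \<sigma> k (a (Suc n + e - k)) * \<sigma> e (a n) - \<sigma> k (a (n + e - k)) * \<sigma> e (a (Suc n))"
    have "{1..Suc (n + e)} = insert (Suc (n + e)) {1..n + e}" by auto
    then have a1: "a (Suc n + e) = A (Suc (n + e)) * \<sigma> (Suc (n + e)) (a 0)
          + (\<Sum>k\<in>{1..n + e}. A k * \<sigma> k (a (Suc n + e - k)))"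
      using rec[of "Suc n + e"] by simp
    have a2: "a (n + e) = (\<Sum>k\<in>{1..n + e}. A k * \<sigma> k (a (n + e - k)))"
      using rec[of "n + e"] False by simp
    have "?D n e = A (Suc (n + e)) * \<sigma> (Suc (n + e)) (a 0) * \<sigma> e (a n)
          + (\<Sum>k\<in>{1..n + e}. A k * ?T k)"
      unfolding a1 a2
      by (simp add: ring_distribs sum_distrib_right sum_subtractf mult.assoc)
    moreover have "of_nat p ^ Suc n dvd A (Suc (n + e))"
      using A[of "n + e"] False by (intro dvd_trans[OF le_imp_power_dvd A]) simp
    moreover have "of_nat p ^ Suc n dvd A k * ?T k" if k: "k \<in> {1..n + e}" for k
    proof (cases "k \<le> e")
      case True
      define d where "d = e - k"
      have e: "e = k + d" using True d_def by simp
      have "?T k = \<sigma> k (?D n d)"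
        by (simp add: e diff mult comp)
      moreover have "of_nat p ^ Suc n dvd ?D n d"
        using less k e by simp
      ultimately show ?thesis by (metis \<sigma>_dvd dvd_mult)
    next
      case False
      define d m where "d = k - e" and "m = n - d"
      have kn: "k = e + d" "n = m + d" "d > 0" using False k by (auto simp: d_def m_def)
      have "?T k = - \<sigma> e (?D m d)"
        by (simp add: kn diff mult comp mult.commute)
      moreover have "of_nat p ^ Suc m dvd ?D m d"
        using less kn \<open>e \<noteq> 0\<close> by simp
      ultimately have "of_nat p ^ Suc m dvd ?T k" by (metis \<sigma>_dvd dvd_minus_iff)
      moreover have "of_nat p ^ (k - 1) dvd A k" using A[of "k - 1"] kn by simp
      ultimately have "of_nat p ^ (k - 1 + Suc m) dvd A k * ?T k"
        unfolding power_add by (rule mult_dvd_mono[rotated])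
      moreover have "Suc n \<le> k - 1 + Suc m" using kn \<open>e \<noteq> 0\<close> by simp
      ultimately show ?thesis using le_imp_power_dvd dvd_trans by blast
    qed
    ultimately show ?thesis by (metis (no_types, lifting) dvd_add dvd_mult2 dvd_sum)
  qed
qed

section \<open>Substituting powers of the variables\<close>

definition subst_power :: "nat \<Rightarrow> 'a::comm_ring_1 poly \<Rightarrow> 'a poly" where
  "subst_power q f = pcompose f (monom 1 q)"

lemma subst_power_mult: "subst_power q (f * g) = subst_power q f * subst_power q g"
  by (simp add: subst_power_def pcompose_mult)

lemma subst_power_diff: "subst_power q (f - g) = subst_power q f - subst_power q g"
  by (simp add: subst_power_def pcompose_diff)

lemma subst_power_0: "subst_power q 0 = 0"
  by (simp add: subst_power_def)

lemma subst_power_1: "subst_power q 1 = 1"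
  by (simp add: subst_power_def pcompose_1)

lemma subst_power_subst_power: "subst_power q (subst_power r f) = subst_power (q * r) f"
proof -
  have "pcompose (monom 1 r) (monom 1 q) = (monom 1 (q * r) :: 'a poly)"
  proof (induction r)
    case 0
    then show ?case by (simp add: pcompose_1 flip: one_pCons)
  next
    case (Suc r)
    then show ?case by (simp add: monom_Suc pcompose_pCons mult_monom)
  qed
  then show ?thesis by (simp add: subst_power_def flip: pcompose_assoc)
qed

lemma subst_power_Suc_0: "subst_power (Suc 0) f = f"
  using pcompose_idR[of f] by (simp add: subst_power_def monom_altdef)

lemma degree_subst_power_le: "degree (subst_power q f) \<le> q * degree f"
  using degree_pcompose_le[of f "monom 1 q"] order_trans[OF _ mult_le_mono2[OF degree_monom_le]]
  by (metis mult.commute subst_power_def)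

text \<open>
  An exponent \<open>q (m + 1) - 1\<close> of the product needs an exponent of \<open>B\<close> congruent to \<open>-1\<close> modulo
  \<open>q\<close>, and the degree bound excludes all of these but \<open>q - 1\<close>.
\<close>

lemma coeff_mult_subst_power:
  assumes "degree B < 2 * q - 1"
  shows "coeff (B * subst_power q f) (q * Suc m - 1) = coeff B (q - 1) * coeff f m"
proof (induction f arbitrary: m)
  case 0
  then show ?case by (simp add: subst_power_def)
next
  case (pCons a f)
  have q: "q > 0" using assms by (cases q) auto
  have "B * subst_power q (pCons a f) = smult a B + monom 1 q * (B * subst_power q f)"
    by (simp add: subst_power_def pcompose_pCons algebra_simps)
  then have eq: "coeff (B * subst_power q (pCons a f)) (q * Suc m - 1)
      = a * coeff B (q * Suc m - 1)
        + (if q * Suc m - 1 < q then 0 else coeff (B * subst_power q f) (q * Suc m - 1 - q))"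
    by (simp add: coeff_monom_mult)
  show ?case
  proof (cases m)
    case 0
    then show ?thesis using eq q by simp
  next
    case (Suc l)
    have "coeff B (q * Suc m - 1) = 0"
      using assms by (intro coeff_eq_0) (simp add: Suc)
    moreover have "q * Suc m - 1 - q = q * Suc l - 1" "\<not> q * Suc m - 1 < q"
      using q by (simp_all add: Suc)
    ultimately show ?thesis unfolding eq using pCons by (simp add: Suc)
  qed
qed

definition frobenius_twist :: "nat \<Rightarrow> 'a::comm_ring_1 poly poly \<Rightarrow> 'a poly poly" where
  "frobenius_twist q f = subst_power q (map_poly (subst_power q) f)"

lemma frobenius_twist_1: "frobenius_twist q 1 = 1"
  by (simp add: frobenius_twist_def subst_power_1)

lemma frobenius_twist_mult:
  "frobenius_twist q (f * g) = frobenius_twist q f * frobenius_twist q g"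
proof -
  have "map_poly (subst_power q) (f * g) = map_poly (subst_power q) f * map_poly (subst_power q) g"
    by (rule poly_eqI)
      (simp add: coeff_map_poly subst_power_0 coeff_mult subst_power_def pcompose_sum pcompose_mult)
  then show ?thesis by (simp add: frobenius_twist_def subst_power_mult)
qed

lemma degree_frobenius_twist_le: "degree (frobenius_twist q f) \<le> q * degree f"
proof -
  have "degree (map_poly (subst_power q) f) \<le> degree f"
    by (rule degree_le) (simp add: coeff_map_poly subst_power_0 coeff_eq_0)
  then show ?thesis
    unfolding frobenius_twist_def using degree_subst_power_le by (meson mult_le_mono2 order_trans)
qed

text \<open>
  For \<open>c = 0\<close>, \<open>c = 1\<close> and \<open>c = x\<close> these are the three linear factors of the master polynomial.
\<close>

lemma frobenius_twist_cong_linear: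
  assumes "prime p" "odd p" "subst_power (p ^ k) c = c ^ (p ^ k)"
  shows "of_nat p dvd [:- c, 1:] ^ (p ^ k) - frobenius_twist (p ^ k) [:- c, 1:]"
proof -
  let ?q = "p ^ k"
  have odd: "odd ?q" using assms by simp
  have "frobenius_twist ?q [:- c, 1:] = [:- (c ^ ?q):] + [:0, 1:] ^ ?q"
    using assms(3)
    by (simp add: frobenius_twist_def map_poly_pCons subst_power_0 subst_power_1)
       (simp add: subst_power_def pcompose_pCons monom_altdef pcompose_uminus)
  also have "[:- (c ^ ?q):] = [:- c:] ^ ?q"
    using odd by (simp add: poly_const_pow)
  finally show ?thesis
    using prime_dvd_power_add_diff[OF assms(1), of "[:- c:]" "[:0, 1:]" k] by simp
qed

text \<open>
  The bound \<open>deg F\<^sub>s \<le> 3 (p\<^sup>s - 1) / 2\<close> is inherited because it is additive along the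
  decomposition: \<open>(p\<^sup>k - 1) + p\<^sup>k (p\<^sup>s\<^sup>-\<^sup>k - 1) = p\<^sup>s - 1\<close>. It is stated without
  subtraction and division.
\<close>

lemma degree_indecomposable:
  fixes F :: "nat \<Rightarrow> 'a::comm_ring_1 poly poly"
  assumes deg: "\<And>s. 2 * degree (F s) + 3 \<le> 3 * p ^ s"
  shows "2 * degree (indecomposable (\<lambda>k. frobenius_twist (p ^ k)) F s) + 3 \<le> 3 * p ^ s"
proof (induction s rule: less_induct)
  case (less s)
  let ?B = "indecomposable (\<lambda>k. frobenius_twist (p ^ k)) F"
  have "degree (?B s) \<le> (3 * p ^ s - 3) div 2"
  proof (subst indecomposable.simps, intro degree_diff_le degree_sum_le)
    show "degree (F s) \<le> (3 * p ^ s - 3) div 2" using deg[of s] by linarith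
    fix k assume k: "k \<in> {1..<s}"
    have "p ^ k * (2 * degree (F (s - k)) + 3) \<le> p ^ k * (3 * p ^ (s - k))"
      using deg by (rule mult_le_mono2)
    also have "\<dots> = 3 * p ^ s" using k by (simp flip: power_add)
    finally have "2 * (p ^ k * degree (F (s - k))) + 3 * p ^ k \<le> 3 * p ^ s"
      by (simp add: algebra_simps)
    moreover have "2 * degree (?B k) + 3 \<le> 3 * p ^ k" using less k by simp
    moreover have "degree (?B k * frobenius_twist (p ^ k) (F (s - k)))
        \<le> degree (?B k) + p ^ k * degree (F (s - k))"
      using degree_mult_le degree_frobenius_twist_le by (meson add_left_mono order_trans)
    ultimately show "degree (?B k * frobenius_twist (p ^ k) (F (s - k))) \<le> (3 * p ^ s - 3) div 2"
      by linarith
  qed simp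
  moreover have "3 \<le> 3 * p ^ s" using deg[of s] by linarith
  ultimately show ?case by linarith
qed

section \<open>The master polynomials\<close>

lemma half_power_diff:
  fixes p :: nat
  assumes "odd p"
  shows "(p ^ s - 1) div 2 = (p - 1) div 2 * (\<Sum>i<s. p ^ i)"
proof -
  have p: "1 \<le> p" using assms by (cases p) auto
  have "int (p ^ s - 1) = int ((p - 1) * (\<Sum>i<s. p ^ i))"
    using power_diff_1_eq[of "int p" s] p one_le_power[OF p, of s] by (simp add: of_nat_diff)
  then have "p ^ s - 1 = (p - 1) * (\<Sum>i<s. p ^ i)" by (simp only: of_nat_eq_iff)
  moreover have "p - 1 = 2 * ((p - 1) div 2)" using assms by simp
  ultimately show ?thesis by (metis mult.assoc nonzero_mult_div_cancel_left zero_neq_numeral)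
qed

lemma master_poly_eq_prod:
  assumes "odd p"
  shows "master_poly p s = (\<Prod>i<s. master_poly p 1 ^ (p ^ i))"
  unfolding master_poly_def half_power_diff[OF assms]
  by (simp add: power_sum power_mult power_mult_distrib prod.distrib)

lemma degree_master_poly:
  assumes "odd p"
  shows "2 * degree (master_poly p s) + 3 \<le> 3 * p ^ s"
proof -
  let ?m = "(p ^ s - 1) div 2"
  have lin: "degree ([:c, 1:] ^ ?m :: int poly poly) \<le> ?m" for c
    by (rule order_trans[OF degree_power_le]) simp
  have "degree (master_poly p s) \<le> ?m + ?m + ?m"
    unfolding master_poly_def by (intro order_trans[OF degree_mult_le] add_mono lin)
  moreover have "p ^ s > 0" using assms by (simp add: odd_pos)
  ultimately show ?thesis by linarith
qed

lemma P_eq_coeff_master_poly: "P p s = coeff (master_poly p s) (p ^ s - 1)"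
  by (simp add: P_def master_poly_def)

lemma frobenius_twist_cong_master_poly:
  assumes "prime p" "odd p"
  shows "of_nat p dvd master_poly p 1 ^ (p ^ k) - frobenius_twist (p ^ k) (master_poly p 1)"
proof -
  let ?q = "p ^ k" and ?h = "(p - 1) div 2"
  have pow: "frobenius_twist ?q (f ^ n) = frobenius_twist ?q f ^ n" for f :: "int poly poly" and n
    by (induction n) (simp_all add: frobenius_twist_1 frobenius_twist_mult)
  have lin: "of_nat p dvd ([:- c, 1:] ^ ?h) ^ ?q - frobenius_twist ?q ([:- c, 1:] ^ ?h)"
    if "subst_power ?q c = c ^ ?q" for c :: "int poly"
    using dvd_power_diff[OF frobenius_twist_cong_linear[OF assms that], of ?h]
    by (simp add: pow mult.commute flip: power_mult)
  have q: "?q > 0" using assms by (simp add: odd_pos)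
  have 0: "of_nat p dvd ([:0, 1:] ^ ?h) ^ ?q - frobenius_twist ?q ([:0, 1:] ^ ?h :: int poly poly)"
    using lin[of 0] q by (simp add: subst_power_0 power_0_left)
  have 1: "of_nat p dvd ([:- 1, 1:] ^ ?h) ^ ?q - frobenius_twist ?q ([:- 1, 1:] ^ ?h :: int poly poly)"
    using lin[of 1] by (simp add: subst_power_1)
  have x: "of_nat p dvd ([:- [:0, 1:], 1:] ^ ?h) ^ ?q
      - frobenius_twist ?q ([:- [:0, 1:], 1:] ^ ?h :: int poly poly)"
    by (rule lin) (simp add: subst_power_def pcompose_pCons monom_altdef)
  show ?thesis
    unfolding master_poly_def power_one_right frobenius_twist_mult power_mult_distrib
    by (intro dvd_mult_diff 0 1 x)
qed

lemma of_nat_power_dvd_coeff: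
  assumes "of_nat p ^ k dvd (f :: 'a::comm_ring_1 poly)"
  shows "of_nat p ^ k dvd coeff f n"
proof -
  have "(of_nat p ^ k :: 'a poly) = [:of_nat p ^ k:]"
    by (simp add: of_nat_poly poly_const_pow)
  with assms have "[:of_nat p ^ k:] dvd f" by (simp only:)
  then show ?thesis by (auto elim!: dvdE)
qed

lemma P_recursion:
  assumes "prime p" "odd p"
  obtains A where "\<And>k. of_nat p ^ k dvd A (Suc k)"
    and "\<And>s. s \<ge> 1 \<Longrightarrow> P p s = (\<Sum>k\<in>{1..s}. A k * subst_power (p ^ k) (P p (s - k)))"
proof
  let ?\<tau> = "\<lambda>k. frobenius_twist (p ^ k) :: int poly poly \<Rightarrow> int poly poly"
  let ?B = "indecomposable ?\<tau> (master_poly p)"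
  let ?A = "\<lambda>k. coeff (?B k) (p ^ k - 1)"
  show "of_nat p ^ k dvd ?A (Suc k)" for k
    by (rule of_nat_power_dvd_coeff, rule power_dvd_indecomposable[where \<Phi> = "master_poly p 1"])
      (rule master_poly_eq_prod frobenius_twist_1 frobenius_twist_mult
        frobenius_twist_cong_master_poly assms)+
  show "P p s = (\<Sum>k\<in>{1..s}. ?A k * subst_power (p ^ k) (P p (s - k)))" if "s \<ge> 1" for s
  proof -
    have "P p s = (\<Sum>k\<in>{1..s}. coeff (?B k * ?\<tau> k (master_poly p (s - k))) (p ^ s - 1))"
      unfolding P_eq_coeff_master_poly coeff_sum[symmetric]
      using that by (subst sum_indecomposable[of ?\<tau>]) (simp_all add: master_poly_def frobenius_twist_1)
    also have "\<dots> = (\<Sum>k\<in>{1..s}. ?A k * subst_power (p ^ k) (P p (s - k)))"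
    proof (rule sum.cong[OF refl])
      fix k assume k: "k \<in> {1..s}"
      have "1 < p" using assms(1) prime_gt_1_nat by blast
      then have gt: "0 < p ^ k" by simp
      \<comment> \<open>\<open>3 (p\<^sup>k - 1) / 2 < 2 p\<^sup>k - 1\<close>, which leaves \<open>2 p\<^sup>k - 1\<close>, the next exponent congruent
        to \<open>-1\<close>, out of reach\<close>
      have deg: "degree (?B k) < 2 * p ^ k - 1"
        using degree_indecomposable[OF degree_master_poly[OF assms(2)], of k] gt by linarith
      have "p ^ s = p ^ k * Suc (p ^ (s - k) - 1)"
        using k \<open>1 < p\<close> by (simp flip: power_add)
      then show "coeff (?B k * ?\<tau> k (master_poly p (s - k))) (p ^ s - 1)
          = ?A k * subst_power (p ^ k) (P p (s - k))"
        using coeff_mult_subst_power[OF deg]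
        by (simp add: frobenius_twist_def coeff_map_poly subst_power_0 P_eq_coeff_master_poly del: mult_Suc_right)
    qed
    finally show ?thesis .
  qed
qed

theorem theorem4p2:
  fixes p s :: nat
  assumes "prime p" and "odd p" and "s \<ge> 1"
  shows "\<forall>n. [coeff (P p (s + 1) * pcompose (P p (s - 1)) (monom 1 p)) n
             = coeff (P p s * pcompose (P p s) (monom 1 p)) n] (mod int p ^ s)"
proof
  fix n
  obtain A where A: "\<And>k. of_nat p ^ k dvd A (Suc k)"
    and rec: "\<And>s. s \<ge> 1 \<Longrightarrow> P p s = (\<Sum>k\<in>{1..s}. A k * subst_power (p ^ k) (P p (s - k)))"
    using P_recursion[OF assms(1,2)] by blast
  \<comment> \<open>the case \<open>n = s - 1\<close>, \<open>e = 1\<close> of the general congruence\<close>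
  have "of_nat p ^ Suc (s - 1) dvd
      P p (Suc (s - 1) + 1) * subst_power (p ^ 1) (P p (s - 1))
      - P p (s - 1 + 1) * subst_power (p ^ 1) (P p (Suc (s - 1)))"
    by (rule dwork_congruence_of_recursion[where \<sigma> = "\<lambda>k. subst_power (p ^ k)", OF rec A])
      (simp_all add: subst_power_Suc_0 subst_power_subst_power subst_power_1 subst_power_diff
        subst_power_mult power_add)
  then have "of_nat p ^ s dvd P p (s + 1) * pcompose (P p (s - 1)) (monom 1 p)
      - P p s * pcompose (P p s) (monom 1 p)"
    using assms(3) by (simp add: subst_power_def)
  from of_nat_power_dvd_coeff[OF this, of n]
  show "[coeff (P p (s + 1) * pcompose (P p (s - 1)) (monom 1 p)) n
       = coeff (P p s * pcompose (P p s) (monom 1 p)) n] (mod int p ^ s)"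
    by (simp add: cong_iff_dvd_diff)
qed

end
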